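(* Let $(L,\vee,\wedge,{}',0,1)$ be a non-trivial complete orthomodular lattice, let $(T,R)$ be a time frame, let $P,F,H,G\colon L^T\to L^T$ denote the tense operators induced by $(T,R)$, and let $A\in\{P,F,H,G\}$. Then the following two assertions are equivalent: (i) $A(x)\odot A(y)\leq A(x\odot y)$ for all $x,y\in L^T$; (ii) $A(x\rightarrow y)\leq A(x)\rightarrow A(y)$ for all $x,y\in L^T$.
   Context: An orthomodular lattice is an algebra $(L,\vee,\wedge,{}',0,1)$ such that $(L,\vee,\wedge,0,1)$ is a bounded lattice, $'$ is an antitone involution ($x\leq y$ implies $y'\leq x'$, and $x''=x$), $x\vee x'=1$ and $x\wedge x'=0$ for all $x\in L$, and the orthomodular law holds: if $x\leq y$ then $y=x\vee(y\wedge x')$. It is complete if its underlying lattice is complete; non-trivial means that $L$ has more than one element. On $L$ one defines $x\odot y:=(x\vee y')\wedge y$ and $x\rightarrow y:=(y\wedge x)\vee x'$. A time frame is a pair $(T,R)$ consisting of a non-empty set $T$ and a non-empty binary relation $R\subseteq T\times T$; $s\mathrel R t$ means $(s,t)\in R$. $L^T$ is the set of all functions $T\to L$, with order and operations (including $\odot$ and $\rightarrow$) defined pointwise. The tense operators $P,F,H,G\colon L^T\to L^T$ induced by $(T,R)$ are defined, for $q\in L^T$ and $s\in T$, by $P(q)(s):=\bigvee\{q(t)\mid t\mathrel R s\}$, $F(q)(s):=\bigvee\{q(t)\mid s\mathrel R t\}$, $H(q)(s):=\bigwedge\{q(t)\mid t\mathrel R s\}$, $G(q)(s):=\bigwedge\{q(t)\mid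 s\mathrel R t\}$, where the join of the empty set is $0$ and the meet of the empty set is $1$. *)

theory Defs
  imports "HOL-Library.Complemented_Lattices" "HOL-Library.FuncSet"
begin

unbundle lattice_syntax

(* L is a type of class complete_orthomodular_lattice, with - x for the orthocomplement x'.
   The class also has a binary minus, but fixes it to x - y = inf x (- y), so this adds nothing
   to the structure. *)

definition sasaki_conj :: "'a::orthomodular_lattice \<Rightarrow> 'a \<Rightarrow> 'a" (infixl "\<odot>" 70) where
  "x \<odot> y = (x \<squnion> - y) \<sqinter> y"

definition sasaki_imp :: "'a::orthomodular_lattice \<Rightarrow> 'a \<Rightarrow> 'a" (infixr "\<rightarrow>\<^sub>S" 60) where
  "x \<rightarrow>\<^sub>S y = (y \<sqinter> x) \<squnion> - x"

definition time_frame :: "'t set \<Rightarrow> ('t \<times> 't) set \<Rightarrow> bool" where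
  "time_frame T R \<longleftrightarrow> T \<noteq> {} \<and> R \<noteq> {} \<and> R \<subseteq> T \<times> T"

(* L^T is the set of extensional functions from T to L, i.e. those that are undefined outside T.
   Operations on L^T therefore restrict their results to T. *)

abbreviation powers :: "'t set \<Rightarrow> ('t \<Rightarrow> 'a) set" where
  "powers T \<equiv> T \<rightarrow>\<^sub>E UNIV"

definition le_on :: "'t set \<Rightarrow> ('t \<Rightarrow> 'a::order) \<Rightarrow> ('t \<Rightarrow> 'a) \<Rightarrow> bool" where
  "le_on T x y \<longleftrightarrow> (\<forall>s\<in>T. x s \<le> y s)"

definition conj_on ::
  "'t set \<Rightarrow> ('t \<Rightarrow> 'a::orthomodular_lattice) \<Rightarrow> ('t \<Rightarrow> 'a) \<Rightarrow> 't \<Rightarrow> 'a" where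
  "conj_on T x y = (\<lambda>s\<in>T. x s \<odot> y s)"

definition imp_on ::
  "'t set \<Rightarrow> ('t \<Rightarrow> 'a::orthomodular_lattice) \<Rightarrow> ('t \<Rightarrow> 'a) \<Rightarrow> 't \<Rightarrow> 'a" where
  "imp_on T x y = (\<lambda>s\<in>T. x s \<rightarrow>\<^sub>S y s)"

definition tense_P ::
  "'t set \<Rightarrow> ('t \<times> 't) set \<Rightarrow> ('t \<Rightarrow> 'a::complete_lattice) \<Rightarrow> 't \<Rightarrow> 'a" where
  "tense_P T R q = (\<lambda>s\<in>T. \<Squnion>{q t |t. (t, s) \<in> R})"

definition tense_F ::
  "'t set \<Rightarrow> ('t \<times> 't) set \<Rightarrow> ('t \<Rightarrow> 'a::complete_lattice) \<Rightarrow> 't \<Rightarrow> 'a" where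
  "tense_F T R q = (\<lambda>s\<in>T. \<Squnion>{q t |t. (s, t) \<in> R})"

definition tense_H ::
  "'t set \<Rightarrow> ('t \<times> 't) set \<Rightarrow> ('t \<Rightarrow> 'a::complete_lattice) \<Rightarrow> 't \<Rightarrow> 'a" where
  "tense_H T R q = (\<lambda>s\<in>T. \<Sqinter>{q t |t. (t, s) \<in> R})"

definition tense_G ::
  "'t set \<Rightarrow> ('t \<times> 't) set \<Rightarrow> ('t \<Rightarrow> 'a::complete_lattice) \<Rightarrow> 't \<Rightarrow> 'a" where
  "tense_G T R q = (\<lambda>s\<in>T. \<Sqinter>{q t |t. (s, t) \<in> R})"

end

theory Submission
  imports Defs
begin

text \<open>The Sasaki operations form an adjoint pair: \<open>x \<odot> y \<le> z\<close> iff \<open>x \<le> y \<rightarrow>\<^sub>S z\<close>. For a monotone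
  operator \<open>A\<close>, applying \<open>A\<close> to the unit \<open>x \<le> y \<rightarrow>\<^sub>S (x \<odot> y)\<close> turns (ii) into (i), and applying
  it to the counit \<open>(x \<rightarrow>\<^sub>S y) \<odot> x \<le> y\<close> turns (i) into (ii).\<close>

text \<open>The orthomodular law for \<open>- y \<le> - x\<close>, with both sides complemented by
  De Morgan.\<close>

lemma orthomodular_dual:
  fixes x y :: "'a::orthomodular_lattice"
  assumes "x \<le> y"
  shows "(x \<squnion> - y) \<sqinter> y = x"
proof -
  have "- y \<squnion> (- x) \<sqinter> y = - x"
    using orthomodular[of "- y" "- x"] assms by (simp add: inf_commute)
  then have "- (- y \<squnion> (- x) \<sqinter> y) = x"
    by simp
  then show ?thesis
    by (simp add: inf_commute sup_commute)
qed

lemma sasaki_adjoint: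
  fixes x y z :: "'a::orthomodular_lattice"
  shows "x \<odot> y \<le> z \<longleftrightarrow> x \<le> y \<rightarrow>\<^sub>S z"
proof
  assume le: "x \<odot> y \<le> z"
  have "x \<le> x \<squnion> - y"
    by simp
  \<comment> \<open>The orthomodular law for \<open>- y \<le> x \<squnion> - y\<close> makes
    \<open>x \<odot> y\<close> appear as a joinand.\<close>
  also have "\<dots> = - y \<squnion> (x \<squnion> - y) \<sqinter> y"
    using orthomodular[of "- y" "x \<squnion> - y"] by (simp add: inf_commute)
  also have "\<dots> \<le> - y \<squnion> z \<sqinter> y"
    using le unfolding sasaki_conj_def by (intro sup_mono) auto
  finally show "x \<le> y \<rightarrow>\<^sub>S z"
    by (simp add: sasaki_imp_def sup_commute)
next
  assume "x \<le> y \<rightarrow>\<^sub>S z"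
  \<comment> \<open>The bound on \<open>x\<close> already lies above \<open>- y\<close>, so it also
    bounds \<open>x \<squnion> - y\<close>.\<close>
  then have "(x \<squnion> - y) \<sqinter> y \<le> (z \<sqinter> y \<squnion> - y) \<sqinter> y"
    unfolding sasaki_imp_def by (intro inf_mono) auto
  also have "\<dots> = z \<sqinter> y"
    by (intro orthomodular_dual) simp
  finally show "x \<odot> y \<le> z"
    by (simp add: sasaki_conj_def)
qed

text \<open>Adjointness lifts to functions because the order and both operations are pointwise on
  \<open>T\<close>.\<close>

lemma conj_on_le_iff: "le_on T (conj_on T x y) z \<longleftrightarrow> le_on T x (imp_on T y z)"
  by (simp add: le_on_def conj_on_def imp_on_def sasaki_adjoint)

lemma le_on_refl: "le_on T x x"
  by (simp add: le_on_def)

lemma le_on_trans: "le_on T x y \<Longrightarrow> le_on T y z \<Longrightarrow> le_on T x z"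
  unfolding le_on_def by (meson order_trans)

lemma conj_on_in_powers: "conj_on T x y \<in> powers T"
  by (simp add: conj_on_def)

lemma imp_on_in_powers: "imp_on T x y \<in> powers T"
  by (simp add: imp_on_def)

lemma tense_mono:
  fixes A :: "('t \<Rightarrow> 'a::complete_lattice) \<Rightarrow> ('t \<Rightarrow> 'a)"
  assumes "R \<subseteq> T \<times> T"
    and "A \<in> {tense_P T R, tense_F T R, tense_H T R, tense_G T R}"
    and "le_on T x y"
  shows "le_on T (A x) (A y)"
proof -
  \<comment> \<open>The hypothesis compares values on \<open>T\<close> only;
    \<open>R \<subseteq> T \<times> T\<close> puts both ends of each related pair there.\<close>
  have le: "x s \<le> y s" "x t \<le> y t" if "(s, t) \<in> R" for s t
    using assms(1,3) that by (auto simp: le_on_def)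
  \<comment> \<open>\<open>Q\<close> will be either "predecessor of \<open>s\<close>" or "successor
    of \<open>s\<close>", which covers all four operators.\<close>
  have Sup_le: "\<Squnion>{x t |t. Q t} \<le> \<Squnion>{y t |t. Q t}"
    and Inf_le: "\<Sqinter>{x t |t. Q t} \<le> \<Sqinter>{y t |t. Q t}" if "\<And>t. Q t \<Longrightarrow> x t \<le> y t" for Q
    using that by (blast intro!: Sup_mono, blast intro!: Inf_mono)
  show ?thesis
    unfolding le_on_def
  proof
    fix s
    assume "s \<in> T"
    with assms(2) show "A x s \<le> A y s"
      by (auto simp: tense_P_def tense_F_def tense_H_def tense_G_def
          intro!: Sup_le Inf_le intro: le)
  qed
qed

lemma conj_imp_transfer:
  fixes A :: "('t \<Rightarrow> 'a::orthomodular_lattice) \<Rightarrow> ('t \<Rightarrow> 'a)"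
  assumes mono: "\<And>x y. le_on T x y \<Longrightarrow> le_on T (A x) (A y)"
  shows "(\<forall>x\<in>powers T. \<forall>y\<in>powers T. le_on T (conj_on T (A x) (A y)) (A (conj_on T x y)))
     \<longleftrightarrow> (\<forall>x\<in>powers T. \<forall>y\<in>powers T. le_on T (A (imp_on T x y)) (imp_on T (A x) (A y)))"
    (is "?conj \<longleftrightarrow> ?imp")
proof
  assume conj: ?conj
  have "le_on T (A (imp_on T x y)) (imp_on T (A x) (A y))" if "x \<in> powers T" for x y
  proof -
    have "le_on T (conj_on T (A (imp_on T x y)) (A x)) (A (conj_on T (imp_on T x y) x))"
      using conj[THEN bspec, OF imp_on_in_powers, THEN bspec, OF that] .
    \<comment> \<open>The counit is reflexivity of \<open>imp_on T x y\<close>, transposed by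
      adjointness.\<close>
    moreover have "le_on T (A (conj_on T (imp_on T x y) x)) (A y)"
      by (intro mono) (simp add: conj_on_le_iff le_on_refl)
    ultimately show ?thesis
      unfolding conj_on_le_iff[symmetric] by (rule le_on_trans)
  qed
  then show ?imp
    by simp
next
  assume imp: ?imp
  have "le_on T (conj_on T (A x) (A y)) (A (conj_on T x y))" if "y \<in> powers T" for x y
  proof -
    \<comment> \<open>The unit is reflexivity of \<open>conj_on T x y\<close>, transposed the other
      way.\<close>
    have "le_on T (A x) (A (imp_on T y (conj_on T x y)))"
      by (intro mono) (simp add: conj_on_le_iff[symmetric] le_on_refl)
    moreover have "le_on T (A (imp_on T y (conj_on T x y))) (imp_on T (A y) (A (conj_on T x y)))"
      using imp[THEN bspec, OF that, THEN bspec, OF conj_on_in_powers] .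
    ultimately show ?thesis
      unfolding conj_on_le_iff by (rule le_on_trans)
  qed
  then show ?conj
    by simp
qed

theorem theorem4p3:
  fixes T :: "'t set" and R :: "('t \<times> 't) set"
    and A :: "('t \<Rightarrow> 'a::complete_orthomodular_lattice) \<Rightarrow> ('t \<Rightarrow> 'a)"
  assumes nontrivial: "\<exists>a b :: 'a. a \<noteq> b"
    and frame: "time_frame T R"
    and A: "A \<in> {tense_P T R, tense_F T R, tense_H T R, tense_G T R}"
  shows "(\<forall>x\<in>powers T. \<forall>y\<in>powers T. le_on T (conj_on T (A x) (A y)) (A (conj_on T x y)))
     \<longleftrightarrow> (\<forall>x\<in>powers T. \<forall>y\<in>powers T. le_on T (A (imp_on T x y)) (imp_on T (A x) (A y)))"
proof (rule conj_imp_transfer)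
  fix x y :: "'t \<Rightarrow> 'a"
  assume "le_on T x y"
  with frame A show "le_on T (A x) (A y)"
    unfolding time_frame_def by (blast intro: tense_mono)
qed

end
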